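(* For any integers $k \ge 3$ and $l\ge 1$, the energy of the dendrimer $d(l, k)$ satisfies \begin{align*} E(d(l, k)) &< \sum_{j = 0}^{l-1} f_j (k-1)^{(l-1/2)-j} + 2(k-1)^{1/2},\\ E(d(l, k)) &> \sum_{j = 0}^{l-1} f_j (k-1)^{(l-1/2)-j} - 2.4(k-1)^{1/2}, \end{align*} where $$f_j = \begin{cases} 2 \csc\left( \dfrac{\pi}{2j+6} \right) - 2\csc\left( \dfrac{\pi}{2j+2} \right), & j \text{ even},\\ 2 \cot\left( \dfrac{\pi}{2j+6} \right) - 2\cot\left( \dfrac{\pi}{2j+2} \right), & j \text{ odd}. \end{cases}$$ Also, for any integer $l\ge 1$, the energy of the dendrimer $d(l, 2)$ is $$E(d(l, 2)) = 2 \left( \cot\left( \dfrac{\pi}{4l+4} \right) - 1\right).$$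
   Context: For a finite simple graph $G$ with adjacency matrix $A(G)$ having eigenvalues $\lambda_1,\dots,\lambda_n$ (with multiplicity), the energy is $E(G)=\sum_{j=1}^n|\lambda_j|$. For integers $l\ge 1$ and $k\ge 2$, the dendrimer $d(l,k)$ is the rooted tree with $l+1$ levels numbered $0,\dots,l$ (level $0$ consists of the root, level $l$ consists of the leaves) in which every vertex in levels $0,\dots,l-1$ (the internal vertices) has degree $k$; i.e. the root has $k$ children, every vertex in levels $1,\dots,l-1$ has $k-1$ children, and vertices in level $l$ have no children. *)

theory Defs
  imports
    "HOL-Computational_Algebra.Computational_Algebra"
    "Jordan_Normal_Form.Char_Poly"
    "Graph_Theory.Pair_Digraph"
begin

text \<open>
  A finite simple graph is a \<^locale>\<open>pair_graph\<close>, i.e. a finite, symmetric, loop-free digraph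
  without parallel arcs: an edge is a pair of opposite arcs.
\<close>

definition adj_matrix :: "'a pair_pre_digraph \<Rightarrow> 'a list \<Rightarrow> complex mat" where
  "adj_matrix G vs = mat (length vs) (length vs)
     (\<lambda>(i, j). if (vs ! i, vs ! j) \<in> parcs G then 1 else 0)"

text \<open>
  The eigenvalues with multiplicity are the roots of the characteristic polynomial, taken over the
  complex numbers so that there are always as many as vertices; the adjacency matrix of a
  graph being symmetric, they are all real. The choice of the vertex enumeration is immaterial,
  see \<open>energy_eq\<close> below.
\<close>

definition energy :: "'a pair_pre_digraph \<Rightarrow> real" where
  "energy G = (let A = adj_matrix G (SOME vs. distinct vs \<and> set vs = pverts G)
     in \<Sum>\<mu>\<in>#proots (char_poly A). cmod \<mu>)"

text \<open>
  A vertex at level \<open>m\<close> is the list of the \<open>m\<close> choices of a child made on the path leading to it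
  from the root, which is the empty list. At the root there are \<open>k\<close> choices, below it \<open>k - 1\<close>.
\<close>

definition dendrimer_verts :: "nat \<Rightarrow> nat \<Rightarrow> nat list set" where
  "dendrimer_verts l k =
     {xs. length xs \<le> l \<and> (\<forall>i<length xs. xs ! i < (if i = 0 then k else k - 1))}"

definition dendrimer :: "nat \<Rightarrow> nat \<Rightarrow> nat list pair_pre_digraph" where
  "dendrimer l k = \<lparr> pverts = dendrimer_verts l k,
     parcs = {(u, v). u \<in> dendrimer_verts l k \<and> v \<in> dendrimer_verts l k \<and>
                      (\<exists>a. v = u @ [a] \<or> u = v @ [a])} \<rparr>"

definition csc :: "real \<Rightarrow> real" where
  "csc x = 1 / sin x"

definition dendrimer_coeff :: "nat \<Rightarrow> real" where
  "dendrimer_coeff j =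
     (if even j then 2 * csc (pi / (2 * real j + 6)) - 2 * csc (pi / (2 * real j + 2))
      else 2 * cot (pi / (2 * real j + 6)) - 2 * cot (pi / (2 * real j + 2)))"

lemma char_poly_adj_matrix_cong:
  assumes "distinct vs" "distinct ws" "set vs = set ws"
  shows "char_poly (adj_matrix G vs) = char_poly (adj_matrix G ws)"
proof -
  define n where "n = length vs"
  have lw: "length ws = n"
    using assms by (metis distinct_card n_def)
  define P where "P = mat n n (\<lambda>(i, j). if vs ! i = ws ! j then 1 else 0 :: complex)"
  define Q where "Q = mat n n (\<lambda>(i, j). if ws ! i = vs ! j then 1 else 0 :: complex)"
  let ?A = "adj_matrix G vs" and ?B = "adj_matrix G ws"
  have C: "P \<in> carrier_mat n n" "Q \<in> carrier_mat n n" "?A \<in> carrier_mat n n" "?B \<in> carrier_mat n n"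
    by (auto simp: P_def Q_def adj_matrix_def n_def lw[unfolded n_def])
  have mem: "vs ! i \<in> set ws" "ws ! i \<in> set vs" "ws ! i \<in> set ws" if "i < n" for i
    using that assms(3) lw n_def nth_mem by metis+
  have sel: "(\<Sum>j = 0..<n. if x = us ! j then f (us ! j) else 0) = f x"
    if "distinct us" "length us = n" "x \<in> set us" for us and x :: 'a and f :: "_ \<Rightarrow> complex"
  proof -
    have "(\<Sum>j = 0..<n. if x = us ! j then f (us ! j) else 0) =
          (\<Sum>y\<in>set us. if x = y then f y else 0)"
      using that by (intro sum.reindex_bij_betw bij_betw_nth) auto
    then show ?thesis using that by simp
  qed
  have PQ: "P * Q = 1\<^sub>m n"
  proof (rule eq_matI)
    fix i j assume ij: "i < dim_row (1\<^sub>m n)" "j < dim_col (1\<^sub>m n)"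
    then have "(P * Q) $$ (i, j) =
        (\<Sum>m = 0..<n. if vs ! i = ws ! m then (if ws ! m = vs ! j then 1 else 0) else 0)"
      by (auto simp: P_def Q_def scalar_prod_def intro!: sum.cong)
    also have "\<dots> = (if vs ! i = vs ! j then 1 else 0)"
      using ij by (intro sel[OF assms(2) lw mem(1)]) auto
    finally show "(P * Q) $$ (i, j) = 1\<^sub>m n $$ (i, j)"
      using ij assms n_def by (simp add: nth_eq_iff_index_eq)
  qed (auto simp: P_def Q_def)
  have QP: "Q * P = 1\<^sub>m n"
    using mat_mult_left_right_inverse[OF C(1,2) PQ] .
  have "?A * P = P * ?B"
  proof (rule eq_matI)
    fix i j assume "i < dim_row (P * ?B)" "j < dim_col (P * ?B)"
    then have ij: "i < n" "j < n" using C by auto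
    have "(?A * P) $$ (i, j) =
        (\<Sum>m = 0..<n. if ws ! j = vs ! m then (if (vs ! i, vs ! m) \<in> parcs G then 1 else 0) else 0)"
      using ij by (auto simp: P_def adj_matrix_def scalar_prod_def n_def intro!: sum.cong)
    also have "\<dots> = (if (vs ! i, ws ! j) \<in> parcs G then 1 else 0)"
      using ij by (intro sel[OF assms(1) n_def[symmetric] mem(2)]) auto
    also have "\<dots> =
        (\<Sum>m = 0..<n. if vs ! i = ws ! m then (if (ws ! m, ws ! j) \<in> parcs G then 1 else 0) else 0)"
      using ij by (intro sel[OF assms(2) lw mem(1), symmetric]) auto
    also have "\<dots> = (P * ?B) $$ (i, j)"
      using ij lw by (auto simp: P_def adj_matrix_def scalar_prod_def intro!: sum.cong)
    finally show "(?A * P) $$ (i, j) = (P * ?B) $$ (i, j)" .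
  qed (use C in auto)
  then have "?A * P * Q = P * ?B * Q" by simp
  then have "?A = P * ?B * Q"
    using C PQ by (simp add: assoc_mult_mat[OF C(3,1,2)])
  then have "similar_mat ?A ?B"
    using C PQ QP by (intro similar_matI[where P = P and Q = Q and n = n]) auto
  then show ?thesis by (rule char_poly_similar)
qed

lemma energy_eq:
  assumes "distinct vs" "set vs = pverts G"
  shows "energy G = (\<Sum>\<mu>\<in>#proots (char_poly (adj_matrix G vs)). cmod \<mu>)"
proof -
  have "distinct (SOME vs. distinct vs \<and> set vs = pverts G) \<and>
        set (SOME vs. distinct vs \<and> set vs = pverts G) = pverts G"
    by (rule someI[where P = "\<lambda>vs. distinct vs \<and> set vs = pverts G"]) (use assms in blast)
  then show ?thesis
    using char_poly_adj_matrix_cong[OF assms(1)] assms(2) by (metis energy_def)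
qed

lemma finite_dendrimer_verts: "finite (dendrimer_verts l k)"
proof (rule finite_subset)
  show "dendrimer_verts l k \<subseteq> {xs. set xs \<subseteq> {..<k} \<and> length xs \<le> l}"
    by (fastforce simp: dendrimer_verts_def in_set_conv_nth split: if_splits)
qed (simp add: finite_lists_length_le)

lemma pair_graph_dendrimer: "pair_graph (dendrimer l k)"
proof unfold_locales
  show "finite (parcs (dendrimer l k))"
    by (rule finite_subset[of _ "dendrimer_verts l k \<times> dendrimer_verts l k"])
       (auto simp: dendrimer_def finite_dendrimer_verts)
qed (auto simp: dendrimer_def finite_dendrimer_verts symmetric_def sym_def)

lemma children_dendrimer:
  assumes "v \<in> dendrimer_verts l k" "length v < l"
  shows "{a. v @ [a] \<in> dendrimer_verts l k} = {..<if v = [] then k else k - 1}"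
  using assms by (auto simp: dendrimer_verts_def nth_append less_Suc_eq)

lemma degree_internal_dendrimer:
  assumes "k \<ge> 1" "v \<in> dendrimer_verts l k" "length v < l"
  shows "card {w. (v, w) \<in> parcs (dendrimer l k)} = k"
proof -
  have "{w. (v, w) \<in> parcs (dendrimer l k)} =
      (\<lambda>a. v @ [a]) ` {a. v @ [a] \<in> dendrimer_verts l k} \<union> (if v = [] then {} else {butlast v})"
  proof (cases v rule: rev_exhaust)
    case Nil
    then show ?thesis using assms by (auto simp: dendrimer_def)
  next
    case (snoc u b)
    have "u ! i < (if i = 0 then k else k - 1)" if "i < length u" for i
    proof -
      have "(u @ [b]) ! i < (if i = 0 then k else k - 1)"
        using assms(2) that unfolding snoc dendrimer_verts_def by simp
      then show ?thesis using that by (simp only: nth_append if_True)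
    qed
    then have "u \<in> dendrimer_verts l k"
      using assms(2) unfolding snoc by (simp add: dendrimer_verts_def)
    then show ?thesis using assms snoc by (auto simp: dendrimer_def)
  qed
  moreover have "butlast v \<noteq> v @ [a]" for a
    by (rule notI, drule arg_cong[where f = length]) simp
  moreover have "card ((\<lambda>a. v @ [a]) ` {a. v @ [a] \<in> dendrimer_verts l k}) =
      (if v = [] then k else k - 1)"
    by (subst card_image) (auto simp: inj_on_def children_dendrimer[OF assms(2,3)])
  moreover have "finite {a. v @ [a] \<in> dendrimer_verts l k}"
    by (simp add: children_dendrimer[OF assms(2,3)])
  ultimately show ?thesis
    using assms(1) by (auto simp: card_Un_disjoint card_insert_if)
qed

end

theory Submission
  imports Defs
begin

text \<open>
  Eliminating the vertices of the tree from the leaves upwards writes the characteristic polynomial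
  of the dendrimer as a product over the vertices of quotients of successive rescaled Chebyshev
  polynomials \<open>P\<^sub>j\<close>, where \<open>P\<^sub>j\<^sub>+\<^sub>1 = x P\<^sub>j - q P\<^sub>j\<^sub>-\<^sub>1\<close> and \<open>q = k - 1\<close>; only the root contributes
  another factor, \<open>R = P\<^sub>l\<^sub>+\<^sub>1 - P\<^sub>l\<^sub>-\<^sub>1\<close>. The zeros of \<open>P\<^sub>j\<close> are those of a path scaled by
  \<open>\<surd>q\<close>, and summation over the levels gives the main sum of the theorem minus the energy
  of \<open>P\<^sub>l\<^sub>+\<^sub>1\<close> plus that of \<open>R\<close>. By the intermediate value theorem the zeros of \<open>R\<close> lie between
  those of the (scaled) Chebyshev polynomials \<open>T\<^sub>l\<^sub>+\<^sub>1\<close> and \<open>U\<^sub>l\<^sub>+\<^sub>1\<close>, so the energy of \<open>R\<close> exceeds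
  that of \<open>P\<^sub>l\<^sub>+\<^sub>1\<close> by a number between \<open>0\<close> and \<open>2\<surd>q\<close>. For \<open>q = 1\<close> the zeros of \<open>R\<close> are
  exactly those of \<open>T\<^sub>l\<^sub>+\<^sub>1\<close>.
\<close>

section \<open>Energies of polynomials and symmetric sets of zeros\<close>

definition root_energy :: "complex poly \<Rightarrow> real" where
  "root_energy p = (\<Sum>\<mu>\<in>#proots p. cmod \<mu>)"

lemma root_energy_1 [simp]: "root_energy 1 = 0"
  by (simp add: root_energy_def)

lemma root_energy_mult:
  "p \<noteq> 0 \<Longrightarrow> r \<noteq> 0 \<Longrightarrow> root_energy (p * r) = root_energy p + root_energy r"
  by (simp add: root_energy_def proots_mult)

lemma root_energy_prod:
  assumes "\<And>x. x \<in> S \<Longrightarrow> f x \<noteq> 0"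
  shows "root_energy (\<Prod>x\<in>S. f x) = (\<Sum>x\<in>S. root_energy (f x))"
  using assms by (induction S rule: infinite_finite_induct) (auto simp: root_energy_mult)

text \<open>Every point of \<open>S\<close> is a root of multiplicity at least one, and
  \<open>p\<close> has at most \<open>degree p\<close> roots with multiplicity, so no further or
  multiple root fits.\<close>

lemma proots_eq_mset_set:
  assumes "p \<noteq> 0" "finite S" "degree p \<le> card S" "\<And>x. x \<in> S \<Longrightarrow> poly p x = 0"
  shows "proots p = mset_set S"
proof -
  have "mset_set S \<subseteq># proots p"
  proof (rule mset_subset_eqI)
    fix x show "count (mset_set S) x \<le> count (proots p) x"
      using assms order_root[of p x] by (cases "x \<in> S") auto
  qed
  moreover have "size (proots p) \<le> size (mset_set S)"
    using size_proots_le[of p] assms(3) by simp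
  ultimately show ?thesis
    by (metis mset_subset_size subset_mset.le_imp_less_or_eq not_less)
qed

text \<open>Parity reduces the search for zeros to the positive ones: it adds their negatives and,
  for odd \<open>n\<close>, the zero at the origin. These are \<open>n\<close> distinct points, so
  all zeros are found and are simple.\<close>

lemma root_energy_symmetric:
  fixes p :: "complex poly" and c :: "nat \<Rightarrow> real"
  assumes p: "p \<noteq> 0" "degree p = n" and sym: "\<And>x. poly p (- x) = (- 1) ^ n * poly p x"
    and c: "\<And>i. i \<in> {1..n div 2} \<Longrightarrow> c i > 0" "\<And>i. i \<in> {1..n div 2} \<Longrightarrow> poly p (of_real (c i)) = 0"
    and inj: "inj_on c {1..n div 2}"
  shows "root_energy p = 2 * (\<Sum>i = 1..n div 2. c i)"
proof -
  define C where "C = c ` {1..n div 2}"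
  define Z where "Z = (if odd n then {0} else {} :: real set)"
  define S where "S = complex_of_real ` (C \<union> uminus ` C \<union> Z)"
  have C_pos: "x > 0" if "x \<in> C" for x using that c(1) by (auto simp: C_def)
  have fin: "finite C" "finite Z" by (auto simp: C_def Z_def)
  have "x \<notin> uminus ` C" if "x \<in> C" for x using C_pos[OF that] C_pos by fastforce
  moreover have "0 \<notin> C" using C_pos by blast
  ultimately have disj: "C \<inter> uminus ` C = {}" "(C \<union> uminus ` C) \<inter> Z = {}"
    by (auto simp: Z_def)
  have inj_of_real: "inj_on complex_of_real X" for X by (auto simp: inj_on_def)
  have cardC: "card C = n div 2" using inj by (simp add: C_def card_image)
  have "card S = card (C \<union> uminus ` C \<union> Z)" unfolding S_def by (rule card_image[OF inj_of_real])
  also have "\<dots> = n div 2 + n div 2 + n mod 2"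
    using fin disj cardC by (simp add: card_Un_disjoint card_image Z_def odd_iff_mod_2_eq_one)
  finally have cardS: "card S = n" by presburger
  have zero: "poly p 0 = 0" if "odd n" using sym[of 0] that by simp
  have "proots p = mset_set S"
  proof (rule proots_eq_mset_set)
    show "poly p x = 0" if "x \<in> S" for x
      using that c(2) sym zero by (auto simp: S_def C_def Z_def split: if_splits)
  qed (use p cardS fin in \<open>auto simp: S_def\<close>)
  then have "root_energy p = (\<Sum>x\<in>S. cmod x)"
    by (simp add: root_energy_def sum_unfold_sum_mset)
  also have "\<dots> = (\<Sum>x\<in>C \<union> uminus ` C \<union> Z. \<bar>x\<bar>)"
    unfolding S_def by (subst sum.reindex[OF inj_of_real]) simp
  also have "\<dots> = (\<Sum>x\<in>C. \<bar>x\<bar>) + (\<Sum>x\<in>uminus ` C. \<bar>x\<bar>)"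
    using fin disj by (simp add: sum.union_disjoint Z_def)
  also have "(\<Sum>x\<in>uminus ` C. \<bar>x\<bar>) = (\<Sum>x\<in>C. \<bar>x\<bar>)"
    by (subst sum.reindex) auto
  also have "(\<Sum>x\<in>C. \<bar>x\<bar>) = (\<Sum>x\<in>C. x)"
    using C_pos by (intro sum.cong) (auto simp: less_imp_le)
  also have "\<dots> = (\<Sum>i = 1..n div 2. c i)"
    unfolding C_def by (subst sum.reindex[OF inj]) simp
  finally show ?thesis by simp
qed

section \<open>Rescaled Chebyshev polynomials\<close>

text \<open>For real \<open>q > 0\<close> this is \<open>q^(j/2) U_j(x / (2 sqrt q))\<close> with
  the Chebyshev polynomial \<open>U_j\<close> of the second kind. The ring is left open because
  zeros are located over the reals and counted over the complex numbers.\<close>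

fun branch_poly :: "'a::comm_ring_1 \<Rightarrow> nat \<Rightarrow> 'a poly" where
  "branch_poly q 0 = 1"
| "branch_poly q (Suc 0) = [:0, 1:]"
| "branch_poly q (Suc (Suc j)) = [:0, 1:] * branch_poly q (Suc j) - Polynomial.smult q (branch_poly q j)"

text \<open>The root has \<open>q + 1\<close> children, so for \<open>l \<ge> 1\<close> its pivot is
  \<open>x - (q + 1) P_(l-1) / P_l\<close>, and this is the numerator. Subtraction is truncated:
  \<open>l = 0\<close> gives \<open>x - 1\<close>, which is neither even nor odd.\<close>

definition root_poly :: "'a::comm_ring_1 \<Rightarrow> nat \<Rightarrow> 'a poly" where
  "root_poly q l = branch_poly q (l + 1) - branch_poly q (l - 1)"

lemma degree_branch_poly: "degree (branch_poly q j :: 'a::idom poly) = j \<and> branch_poly q j \<noteq> 0"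
proof (induction q j rule: branch_poly.induct)
  case (3 q j)
  have deg: "degree ([:0, 1:] * branch_poly q (Suc j)) = Suc (Suc j)"
    using 3 by (subst degree_mult_eq) auto
  have "degree (Polynomial.smult q (branch_poly q j)) \<le> j"
    using 3 degree_smult_le[of q "branch_poly q j"] by simp
  then have "degree (branch_poly q (Suc (Suc j))) = Suc (Suc j)"
    using deg unfolding branch_poly.simps diff_conv_add_uminus by (subst degree_add_eq_left) auto
  then show ?case by fastforce
qed auto

lemma branch_poly_nonzero [simp]: "branch_poly q j \<noteq> (0 :: 'a::idom poly)"
  using degree_branch_poly by blast

lemma degree_root_poly: "degree (root_poly q l :: 'a::idom poly) = l + 1"
  using degree_branch_poly[of q] unfolding root_poly_def diff_conv_add_uminus
  by (subst degree_add_eq_left) auto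

lemma root_poly_nonzero [simp]: "root_poly q l \<noteq> (0 :: 'a::idom poly)"
  using degree_root_poly[of q l] by fastforce

lemma poly_branch_poly_minus:
  "poly (branch_poly q j) (- x) = (- 1) ^ j * poly (branch_poly q j) x"
  by (induction q j rule: branch_poly.induct) (auto simp: algebra_simps)

lemma poly_root_poly_minus:
  assumes "l \<ge> 1"
  shows "poly (root_poly q l) (- x) = (- 1) ^ (l + 1) * poly (root_poly q l) x"
  using assms by (cases l) (auto simp: root_poly_def poly_branch_poly_minus algebra_simps)

lemma poly_branch_poly_of_real:
  "poly (branch_poly (of_real q) j) (of_real x) = complex_of_real (poly (branch_poly q j) x)"
  by (induction q j rule: branch_poly.induct) auto

text \<open>The scaled form of \<open>U_j(cos t) sin t = sin((j + 1) t)\<close>; keeping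
  \<open>sin t\<close> on the left avoids a division.\<close>

lemma branch_poly_cos:
  fixes q t :: real
  assumes "q > 0"
  shows "poly (branch_poly q j) (2 * sqrt q * cos t) * sin t = sqrt q ^ j * sin (real (j + 1) * t)"
  using assms
proof (induction q j rule: branch_poly.induct)
  case (2 q)
  show ?case using sin_double[of t] by (simp add: mult_ac)
next
  case (3 q j)
  let ?x = "2 * sqrt q * cos t"
  have rec: "sin (real (j + 3) * t) = 2 * cos t * sin (real (j + 2) * t) - sin (real (j + 1) * t)"
  proof -
    have "real (j + 3) * t = real (j + 2) * t + t" "real (j + 1) * t = real (j + 2) * t - t"
      by (auto simp: algebra_simps)
    then show ?thesis by (simp only: sin_add sin_diff) (simp add: algebra_simps)
  qed
  have "poly (branch_poly q (Suc (Suc j))) ?x * sin t =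
      ?x * (poly (branch_poly q (Suc j)) ?x * sin t) - q * (poly (branch_poly q j) ?x * sin t)"
    by (simp add: algebra_simps)
  also have "\<dots> = ?x * (sqrt q ^ (j + 1) * sin (real (j + 2) * t)) -
      (sqrt q * sqrt q) * (sqrt q ^ j * sin (real (j + 1) * t))"
    using 3 by simp
  also have "\<dots> = sqrt q ^ (j + 2) * (2 * cos t * sin (real (j + 2) * t) - sin (real (j + 1) * t))"
    by (simp only: power_add power_one_right power2_eq_square) (simp only: algebra_simps)
  also have "\<dots> = sqrt q ^ (j + 2) * sin (real (j + 3) * t)" by (simp only: rec)
  finally show ?case by (simp add: numeral_3_eq_3)
qed auto

text \<open>The scales at \<open>l + 1\<close> and \<open>l - 1\<close> differ by the factor
  \<open>q\<close>. For \<open>q = 1\<close> the bracket equals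
  \<open>2 cos((l + 1) t) sin t\<close>, which is the link with \<open>T_(l+1)\<close>.\<close>

lemma root_poly_cos:
  fixes q t :: real
  assumes "q > 0" "l \<ge> 1"
  shows "poly (root_poly q l) (2 * sqrt q * cos t) * sin t =
    sqrt q ^ (l + 1) * (sin (real (l + 2) * t) - sin (real l * t) / q)"
proof -
  obtain h where h: "l = Suc h" using assms(2) by (cases l) auto
  have "sqrt q ^ (l + 1) / q = sqrt q ^ h"
    using assms by (simp add: h field_simps)
  then have "sqrt q ^ (l + 1) * (sin (real (l + 2) * t) - sin (real l * t) / q) =
      sqrt q ^ (l + 1) * sin (real (l + 2) * t) - sqrt q ^ h * sin (real l * t)"
    by (metis right_diff_distrib times_divide_eq_left times_divide_eq_right)
  then show ?thesis
    using branch_poly_cos[OF assms(1), of "l + 1" t] branch_poly_cos[OF assms(1), of h t]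
    by (simp add: root_poly_def h left_diff_distrib del: branch_poly.simps)
qed

section \<open>Closed forms of cosine sums\<close>

text \<open>By the product-to-sum formula, multiplication by \<open>2 sin (a / 2)\<close> makes the
  sum telescope.\<close>

lemma sum_cos_mult:
  fixes a :: real
  shows "2 * sin (a / 2) * (\<Sum>i = 1..m. cos (real i * a)) = sin ((real m + 1 / 2) * a) - sin (a / 2)"
proof (induction m)
  case (Suc m)
  have "2 * sin (a / 2) * cos (real (Suc m) * a) =
      sin (real (Suc m) * a + a / 2) - sin (real (Suc m) * a - a / 2)"
    by (simp add: sin_add sin_diff)
  moreover have "real (Suc m) * a + a / 2 = (real (Suc m) + 1 / 2) * a"
    "real (Suc m) * a - a / 2 = (real m + 1 / 2) * a"
    by (auto simp: field_simps)
  ultimately show ?case using Suc by (simp add: distrib_left)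
qed auto

lemma sum_cos_odd_mult:
  fixes b :: real
  shows "2 * sin b * (\<Sum>i = 1..m. cos ((2 * real i - 1) * b)) = sin (2 * real m * b)"
proof (induction m)
  case (Suc m)
  have "2 * sin b * cos ((2 * real (Suc m) - 1) * b) =
      sin ((2 * real (Suc m) - 1) * b + b) - sin ((2 * real (Suc m) - 1) * b - b)"
    by (simp add: sin_add sin_diff)
  moreover have "(2 * real (Suc m) - 1) * b + b = 2 * real (Suc m) * b"
    "(2 * real (Suc m) - 1) * b - b = 2 * real m * b"
    by (auto simp: field_simps)
  ultimately show ?case using Suc by (simp add: distrib_left)
qed auto

text \<open>The energy of the path on \<open>j\<close> vertices, with eigenvalues
  \<open>2 cos (i pi / (j + 1))\<close>: the sum runs over the positive ones, and symmetry doubles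
  it.\<close>

definition path_energy :: "nat \<Rightarrow> real" where
  "path_energy j = 4 * (\<Sum>i = 1..j div 2. cos (real i * (pi / real (j + 1))))"

lemma path_energy_closed:
  "path_energy j = (if even j then 2 * csc (pi / (2 * real j + 2)) - 2
                    else 2 * cot (pi / (2 * real j + 2)) - 2)"
proof -
  define b where "b = pi / (2 * real j + 2)"
  define S where "S = (\<Sum>i = 1..j div 2. cos (real i * (pi / real (j + 1))))"
  have b2: "pi / real (j + 1) = 2 * b" by (simp add: b_def field_simps)
  have sum: "2 * sin b * S = sin ((real (j div 2) + 1 / 2) * (2 * b)) - sin b"
    using sum_cos_mult[of "2 * b" "j div 2"] unfolding S_def b2 by simp
  have pos: "sin b > 0" unfolding b_def
    by (intro sin_gt_zero) (auto simp: field_simps intro!: add_pos_nonneg)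
  \<comment> \<open>Since \<open>(j + 1) b = pi / 2\<close>, the upper angle of the telescoped sum
    is \<open>pi / 2\<close> for even \<open>j\<close> and \<open>pi / 2 - b\<close> for odd
    \<open>j\<close>; this decides between \<open>csc\<close> and \<open>cot\<close>.\<close>
  show ?thesis
  proof (cases "even j")
    case True
    then have "(real (j div 2) + 1 / 2) * (2 * b) = pi / 2"
      by (auto simp: b_def field_simps elim!: evenE)
    then have "2 * sin b * S = 1 - sin b" using sum by (simp only: sin_pi_half)
    then have "4 * S = 2 * csc b - 2" using pos by (simp add: csc_def field_simps)
    then show ?thesis using True by (simp add: path_energy_def S_def b_def)
  next
    case False
    then have "(real (j div 2) + 1 / 2) * (2 * b) = pi / 2 - b"
      by (auto simp: b_def field_simps elim!: oddE)
    then have "2 * sin b * S = cos b - sin b" using sum by (simp only:) (simp add: sin_diff)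
    then have "4 * S = 2 * cot b - 2" using pos by (simp add: cot_def field_simps)
    then show ?thesis using False by (simp add: path_energy_def S_def b_def)
  qed
qed

text \<open>The sum of the absolute values of the zeros of \<open>T_n(x / 2)\<close>, the positive
  ones being \<open>2 cos ((2 i - 1) pi / (2 n))\<close>.\<close>

definition chebyshev_T_energy :: "nat \<Rightarrow> real" where
  "chebyshev_T_energy n = 4 * (\<Sum>i = 1..n div 2. cos ((2 * real i - 1) * (pi / (2 * real n))))"

lemma chebyshev_T_energy_closed:
  assumes "n \<ge> 2"
  shows "chebyshev_T_energy n = (if even n then 2 * csc (pi / (2 * real n)) else 2 * cot (pi / (2 * real n)))"
proof -
  define b where "b = pi / (2 * real n)"
  define S where "S = (\<Sum>i = 1..n div 2. cos ((2 * real i - 1) * (pi / (2 * real n))))"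
  have sum: "2 * sin b * S = sin (2 * real (n div 2) * b)"
    using sum_cos_odd_mult[of b "n div 2"] unfolding S_def b_def by simp
  have pos: "sin b > 0" unfolding b_def using assms by (intro sin_gt_zero) (auto simp: field_simps)
  show ?thesis
  proof (cases "even n")
    case True
    then have "2 * real (n div 2) * b = pi / 2"
      using assms by (auto simp: b_def field_simps elim!: evenE)
    then have "2 * sin b * S = 1" using sum by (simp only: sin_pi_half)
    then have "4 * S = 2 * csc b" using pos by (simp add: csc_def field_simps)
    then show ?thesis using True by (simp add: chebyshev_T_energy_def S_def b_def)
  next
    case False
    then have "2 * real (n div 2) * b = pi / 2 - b"
      using assms by (auto simp: b_def field_simps elim!: oddE)
    then have "2 * sin b * S = cos b" using sum by (simp only:) (simp add: sin_diff)
    then have "4 * S = 2 * cot b" using pos by (simp add: cot_def field_simps)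
    then show ?thesis using False by (simp add: chebyshev_T_energy_def S_def b_def)
  qed
qed

text \<open>The indices \<open>j\<close> and \<open>j + 2\<close> have the same parity, so the same
  closed form applies to both and the constants \<open>- 2\<close> cancel.\<close>

lemma dendrimer_coeff_eq: "dendrimer_coeff j = path_energy (j + 2) - path_energy j"
  by (simp add: dendrimer_coeff_def path_energy_closed algebra_simps)

section \<open>The characteristic polynomial of a tree\<close>

lemma sorted_by_length_enumeration:
  assumes "finite (V :: 'a list set)"
  obtains vs where "distinct vs" "set vs = V"
    "\<And>i j. i < j \<Longrightarrow> j < length vs \<Longrightarrow> length (vs ! i) \<le> length (vs ! j)"
proof -
  obtain us where us: "distinct us" "set us = V" using finite_distinct_list[OF assms] by blast
  have sorted: "sorted (map length (sort_key length us))" by simp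
  show thesis
  proof (rule that[of "sort_key length us"])
    fix i j assume "i < j" "j < length (sort_key length us)"
    then show "length (sort_key length us ! i) \<le> length (sort_key length us ! j)"
      using sorted_nth_mono[OF sorted, of i j] by simp
  qed (use us in auto)
qed

text \<open>
  Eliminating the vertices of a tree from the leaves upwards: \<open>d v\<close> is the pivot of \<open>v\<close>, and the
  factorisation of \<open>x I - A\<close> is \<open>L D L\<^sup>T\<close>, where \<open>L\<close> is upper unitriangular once the vertices
  are ordered by depth.
\<close>

lemma poly_char_poly_tree:
  fixes V :: "'a list set" and G :: "'a list pair_pre_digraph" and d :: "'a list \<Rightarrow> complex"
  assumes fin: "finite V" and vs: "distinct vs" "set vs = V"
    "\<And>i j. i < j \<Longrightarrow> j < length vs \<Longrightarrow> length (vs ! i) \<le> length (vs ! j)"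
    and arcs: "\<And>u v. u \<in> V \<Longrightarrow> v \<in> V \<Longrightarrow> (u, v) \<in> parcs G \<longleftrightarrow> (\<exists>a. v = u @ [a] \<or> u = v @ [a])"
    and nz: "\<And>u a. u @ [a] \<in> V \<Longrightarrow> d (u @ [a]) \<noteq> 0"
    and pivot: "\<And>u. u \<in> V \<Longrightarrow> d u + (\<Sum>v | v \<in> V \<and> (\<exists>a. v = u @ [a]). 1 / d v) = x"
  shows "poly (char_poly (adj_matrix G vs)) x = (\<Prod>v\<in>V. d v)"
proof -
  define n where "n = length vs"
  define f where "f u v = (if u = v then 1 else if \<exists>a. v = u @ [a] then - 1 / d v else 0)"
    for u v :: "'a list"
  define L where "L = mat n n (\<lambda>(i, j). f (vs ! i) (vs ! j))"
  define D where "D = mat_diag n (\<lambda>i. d (vs ! i))"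
  let ?A = "adj_matrix G vs"
  have A: "?A \<in> carrier_mat n n" by (simp add: adj_matrix_def n_def)
  have L: "L \<in> carrier_mat n n" and D: "D \<in> carrier_mat n n" by (auto simp: L_def D_def)
  have memV: "vs ! i \<in> V" if "i < n" for i using that vs(2) by (auto simp: n_def)
  have entry: "(\<Sum>v\<in>V. f u v * d v * f w v) =
      (if u = w then x else if \<exists>a. w = u @ [a] \<or> u = w @ [a] then - 1 else 0)"
    if "u \<in> V" "w \<in> V" for u w
  proof (cases "u = w")
    case True
    \<comment> \<open>On the diagonal only \<open>u\<close> and its children contribute, which
      leaves the left side of \<open>pivot\<close>.\<close>
    define C where "C = {v. v \<in> V \<and> (\<exists>a. v = u @ [a])}"
    have C: "finite C" "C \<subseteq> V" "u \<notin> C" using fin by (auto simp: C_def)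
    have f_u: "f v v = 1" for v by (simp add: f_def)
    have f_C: "f u v = - 1 / d v \<and> d v \<noteq> 0" if "v \<in> C" for v
      using that nz by (auto simp: C_def f_def)
    have f_0: "f u v = 0" if "v \<in> V - insert u C" for v
      using that unfolding C_def f_def by (simp only: Diff_iff insert_iff mem_Collect_eq) metis
    have "(\<Sum>v\<in>V. f u v * d v * f w v) = (\<Sum>v\<in>V. f u v * d v * f u v)"
      by (simp add: True)
    also have "\<dots> = (\<Sum>v\<in>insert u C. f u v * d v * f u v)"
      using fin that C f_0 by (intro sum.mono_neutral_right) simp_all
    also have "\<dots> = f u u * d u * f u u + (\<Sum>v\<in>C. f u v * d v * f u v)"
      using C(1,3) by (rule sum.insert)
    also have "(\<Sum>v\<in>C. f u v * d v * f u v) = (\<Sum>v\<in>C. 1 / d v)"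
      by (rule sum.cong[OF refl]) (simp add: f_C)
    finally show ?thesis using pivot[OF that(1)] True by (simp add: C_def f_u)
  next
    case False
    show ?thesis
    proof (cases "\<exists>a. w = u @ [a]")
      case True
      then have "(\<Sum>v\<in>V. f u v * d v * f w v) = (\<Sum>v\<in>{w}. f u v * d v * f w v)"
        using fin that by (intro sum.mono_neutral_right) (auto simp: f_def)
      then show ?thesis using True False nz that by (auto simp: f_def)
    next
      case nchild: False
      show ?thesis
      proof (cases "\<exists>a. u = w @ [a]")
        case True
        then have "(\<Sum>v\<in>V. f u v * d v * f w v) = (\<Sum>v\<in>{u}. f u v * d v * f w v)"
          using fin that by (intro sum.mono_neutral_right) (auto simp: f_def)
        then show ?thesis using True False nz that by (auto simp: f_def)
      next
        case nparent: False
        \<comment> \<open>A nonzero term would need \<open>u\<close> and \<open>w\<close> to be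
          parent and child or to have a common child; a vertex has only one parent.\<close>
        have "(\<Sum>v\<in>V. f u v * d v * f w v) = 0"
          using False nchild nparent by (intro sum.neutral) (auto simp: f_def)
        then show ?thesis using False nchild nparent by auto
      qed
    qed
  qed
  \<comment> \<open>\<open>char_matrix A x\<close> stands for \<open>A - x I\<close>, hence the
    sign.\<close>
  have "- char_matrix ?A x = L * D * transpose_mat L"
  proof (rule eq_matI)
    fix i j assume "i < dim_row (L * D * transpose_mat L)" "j < dim_col (L * D * transpose_mat L)"
    then have ij: "i < n" "j < n" using L by auto
    have "(L * D * transpose_mat L) $$ (i, j) =
        (\<Sum>m = 0..<n. f (vs ! i) (vs ! m) * d (vs ! m) * f (vs ! j) (vs ! m))"
      using ij unfolding D_def by (subst mat_diag_mult_right[OF L]) (auto simp: L_def scalar_prod_def)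
    also have "\<dots> = (\<Sum>v\<in>V. f (vs ! i) v * d v * f (vs ! j) v)"
      using vs by (intro sum.reindex_bij_betw bij_betw_nth) (auto simp: n_def)
    also have "\<dots> = (if i = j then x else 0) - ?A $$ (i, j)"
    proof -
      have "?A $$ (i, j) = (if \<exists>a. vs ! j = vs ! i @ [a] \<or> vs ! i = vs ! j @ [a] then 1 else 0)"
        using ij arcs[OF memV memV, OF ij] by (simp add: adj_matrix_def n_def)
      moreover have "vs ! i = vs ! j \<longleftrightarrow> i = j" using ij vs(1) by (simp add: n_def nth_eq_iff_index_eq)
      ultimately show ?thesis using entry[OF memV memV, OF ij] by auto
    qed
    also have "\<dots> = (- char_matrix ?A x) $$ (i, j)"
      using ij A by (simp add: char_matrix_def)
    finally show "(- char_matrix ?A x) $$ (i, j) = (L * D * transpose_mat L) $$ (i, j)" by simp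
  qed (use A L in \<open>auto simp: char_matrix_def\<close>)
  moreover have "det L = 1"
  proof -
    \<comment> \<open>A nonzero entry below the diagonal would make \<open>vs ! j\<close> a child of
      \<open>vs ! i\<close>, hence longer, against the order by depth.\<close>
    have "upper_triangular L"
    proof (rule upper_triangularI)
      fix i j assume ij: "j < i" "i < dim_row L"
      then have n: "i < n" "j < n" using L by auto
      then have "vs ! i \<noteq> vs ! j" using ij vs(1) by (auto simp: n_def nth_eq_iff_index_eq)
      moreover have "length (vs ! j) \<le> length (vs ! i)" using vs(3)[OF ij(1)] n by (simp add: n_def)
      ultimately show "L $$ (i, j) = 0" using n by (auto simp: L_def f_def)
    qed
    then show ?thesis
      using L by (subst det_upper_triangular[OF _ L]) (auto simp: prod_list_diag_prod L_def f_def)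
  qed
  moreover have "det D = (\<Prod>v\<in>V. d v)"
  proof -
    have "det D = (\<Prod>i = 0..<n. d (vs ! i))"
      unfolding D_def by (subst det_upper_triangular[OF _ mat_diag_dim])
        (auto simp: prod_list_diag_prod mat_diag_def upper_triangular_def)
    also have "\<dots> = (\<Prod>v\<in>V. d v)"
      using vs by (intro prod.reindex_bij_betw bij_betw_nth) (auto simp: n_def)
    finally show ?thesis .
  qed
  ultimately have "det (- char_matrix ?A x) = (\<Prod>v\<in>V. d v)"
    using L D by (simp add: det_mult[of _ n] det_transpose)
  then show ?thesis by (simp add: char_poly_matrix[OF A])
qed

section \<open>Levels of the dendrimer\<close>

lemma card_dendrimer_level:
  assumes "m \<le> l"
  shows "card {v \<in> dendrimer_verts l k. length v = m} = (if m = 0 then 1 else k * (k - 1) ^ (m - 1))"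
  using assms
proof (induction m)
  case 0
  have "{v \<in> dendrimer_verts l k. length v = 0} = {[]}" by (auto simp: dendrimer_verts_def)
  then show ?case by simp
next
  case (Suc m)
  define W where "W = {v \<in> dendrimer_verts l k. length v = m}"
  define c where "c = (if m = 0 then k else k - 1)"
  have "{v \<in> dendrimer_verts l k. length v = Suc m} = (\<lambda>(u, a). u @ [a]) ` (W \<times> {..<c})"
  proof (intro equalityI subsetI)
    fix v assume v: "v \<in> {v \<in> dendrimer_verts l k. length v = Suc m}"
    then obtain u a where ua: "v = u @ [a]" by (cases v rule: rev_cases) auto
    have bound: "v ! i < (if i = 0 then k else k - 1)" if "i < Suc m" for i
      using v that by (auto simp: dendrimer_verts_def)
    have "a < c" using bound[of m] v by (auto simp: ua c_def nth_append split: if_splits)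
    moreover have "u ! i < (if i = 0 then k else k - 1)" if "i < m" for i
      using bound[of i] v that by (simp add: ua nth_append)
    then have "u \<in> W" using v by (auto simp: W_def ua dendrimer_verts_def)
    ultimately show "v \<in> (\<lambda>(u, a). u @ [a]) ` (W \<times> {..<c})" by (auto simp: ua)
  next
    fix v assume "v \<in> (\<lambda>(u, a). u @ [a]) ` (W \<times> {..<c})"
    then show "v \<in> {v \<in> dendrimer_verts l k. length v = Suc m}"
      using Suc.prems by (auto simp: W_def c_def dendrimer_verts_def nth_append less_Suc_eq split: if_splits)
  qed
  moreover have "inj_on (\<lambda>(u, a). u @ [a]) (W \<times> {..<c})" by (auto simp: inj_on_def)
  ultimately have "card {v \<in> dendrimer_verts l k. length v = Suc m} = card W * c"
    by (simp add: card_image card_cartesian_product)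
  then show ?case using Suc by (cases m) (auto simp: W_def c_def)
qed

lemma sum_dendrimer_levels:
  fixes g :: "nat \<Rightarrow> real"
  shows "(\<Sum>v\<in>dendrimer_verts l k. g (length v)) =
    g 0 + (\<Sum>m = 1..l. real (k * (k - 1) ^ (m - 1)) * g m)"
proof -
  have "(\<Sum>v\<in>dendrimer_verts l k. g (length v)) =
      (\<Sum>m\<in>{0..l}. \<Sum>v | v \<in> dendrimer_verts l k \<and> length v = m. g (length v))"
    by (rule sum.group[symmetric]) (auto simp: finite_dendrimer_verts, auto simp: dendrimer_verts_def)
  also have "\<dots> = (\<Sum>m\<in>{0..l}. real (if m = 0 then 1 else k * (k - 1) ^ (m - 1)) * g m)"
  proof (rule sum.cong[OF refl])
    fix m assume "m \<in> {0..l}"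
    then show "(\<Sum>v | v \<in> dendrimer_verts l k \<and> length v = m. g (length v)) =
        real (if m = 0 then 1 else k * (k - 1) ^ (m - 1)) * g m"
      using card_dendrimer_level[of m l k] by (simp cong: conj_cong)
  qed
  also have "\<dots> = g 0 + (\<Sum>m = 1..l. real (k * (k - 1) ^ (m - 1)) * g m)"
    by (subst sum.atLeast_Suc_atMost) auto
  finally show ?thesis .
qed

section \<open>Characteristic polynomial and energy of the dendrimer\<close>

text \<open>The pivot at depth \<open>m\<close> is this numerator over
  \<open>branch_poly (of_nat (k - 1)) (l - m)\<close>; the root is special because it has one child
  more.\<close>

definition pivot_num :: "nat \<Rightarrow> nat \<Rightarrow> nat \<Rightarrow> complex poly" where
  "pivot_num l k m = (if m = 0 then root_poly (of_nat (k - 1)) l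
     else branch_poly (of_nat (k - 1)) (l + 1 - m))"

text \<open>The product of the pivots with denominators cleared. Elimination proves it at each
  \<open>x\<close> where no \<open>branch_poly Q j\<close> with \<open>j \<le> l\<close> vanishes; a
  polynomial identity then covers the remaining points.\<close>

lemma char_poly_dendrimer:
  assumes l: "l \<ge> 1" and k: "k \<ge> 1" and vs: "distinct vs" "set vs = dendrimer_verts l k"
    "\<And>i j. i < j \<Longrightarrow> j < length vs \<Longrightarrow> length (vs ! i) \<le> length (vs ! j)"
  shows "char_poly (adj_matrix (dendrimer l k) vs) *
      (\<Prod>v\<in>dendrimer_verts l k. branch_poly (of_nat (k - 1)) (l - length v)) =
    (\<Prod>v\<in>dendrimer_verts l k. pivot_num l k (length v))"
proof -
  define V where "V = dendrimer_verts l k"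
  define p where "p = char_poly (adj_matrix (dendrimer l k) vs)"
  define Q where "Q = (of_nat (k - 1) :: complex)"
  define B where "B = (\<Prod>j = 0..l. branch_poly Q j)"
  have finV: "finite V" by (simp add: V_def finite_dendrimer_verts)
  have lenV: "length v \<le> l" if "v \<in> V" for v using that by (simp add: V_def dendrimer_verts_def)
  have Bnz: "B \<noteq> 0" by (simp add: B_def)
  have "poly p x * (\<Prod>v\<in>V. poly (branch_poly Q (l - length v)) x) =
      (\<Prod>v\<in>V. poly (pivot_num l k (length v)) x)" if "poly B x \<noteq> 0" for x
  proof -
    have nz: "poly (branch_poly Q j) x \<noteq> 0" if "j \<le> l" for j
      using that \<open>poly B x \<noteq> 0\<close> by (auto simp: B_def poly_prod)
    define d where "d v = poly (pivot_num l k (length v)) x / poly (branch_poly Q (l - length v)) x"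
      for v :: "nat list"
    have "poly p x = (\<Prod>v\<in>V. d v)"
      unfolding p_def
    proof (rule poly_char_poly_tree[OF finV vs(1) _ vs(3)])
      show "set vs = V" by (simp add: V_def vs)
      show "(u, v) \<in> parcs (dendrimer l k) \<longleftrightarrow> (\<exists>a. v = u @ [a] \<or> u = v @ [a])"
        if "u \<in> V" "v \<in> V" for u v using that by (auto simp: dendrimer_def V_def)
      \<comment> \<open>A vertex below the root has a numerator of index at most \<open>l\<close>,
        so \<open>nz\<close> covers it; only the numerator of the root may vanish.\<close>
      show "d (u @ [a]) \<noteq> 0" if "u @ [a] \<in> V" for u a
        using lenV[OF that] nz[of "l - length u"] nz[of "l - Suc (length u)"]
        by (auto simp: d_def pivot_num_def Q_def)
      fix u assume u: "u \<in> V"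
      define C where "C = {v. v \<in> V \<and> (\<exists>a. v = u @ [a])}"
      show "d u + (\<Sum>v | v \<in> V \<and> (\<exists>a. v = u @ [a]). 1 / d v) = x"
      proof (cases "length u = l")
        case True
        then have "C = {}" using lenV by (force simp: C_def)
        then have "(\<Sum>v\<in>C. 1 / d v) = 0" by simp
        \<comment> \<open>As \<open>l \<ge> 1\<close>, a leaf is not the root and its pivot is
          \<open>P_1 / P_0 = x\<close>.\<close>
        then show ?thesis using True l by (auto simp: C_def d_def pivot_num_def)
      next
        case False
        then have lt: "length u < l" using lenV[OF u] by simp
        then obtain h where h: "l - length u = Suc h" by (metis Suc_diff_Suc)
        have C: "C = (\<lambda>a. u @ [a]) ` {..<if u = [] then k else k - 1}"
        proof -
          have "C = (\<lambda>a. u @ [a]) ` {a. u @ [a] \<in> V}" unfolding C_def by blast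
          then show ?thesis
            using children_dendrimer[OF u[unfolded V_def] lt] by (simp only: V_def)
        qed
        have d_child: "1 / d v = poly (branch_poly Q h) x / poly (branch_poly Q (Suc h)) x"
          if "v \<in> C" for v
        proof -
          obtain a where a: "v = u @ [a]" using \<open>v \<in> C\<close> by (auto simp: C_def)
          have "l - length v = h" "l + 1 - length v = Suc h" using h by (auto simp: a)
          then show ?thesis by (simp add: d_def pivot_num_def Q_def a)
        qed
        have "card C = (if u = [] then k else k - 1)"
          unfolding C by (subst card_image) (auto simp: inj_on_def)
        then have sum: "(\<Sum>v\<in>C. 1 / d v) = of_nat (if u = [] then k else k - 1) *
            (poly (branch_poly Q h) x / poly (branch_poly Q (Suc h)) x)"
          using d_child by simp
        have nzh: "poly (branch_poly Q (Suc h)) x \<noteq> 0" using nz[of "Suc h"] h by simp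
        have "d u + (\<Sum>v\<in>C. 1 / d v) = x"
        proof (cases "u = []")
          case True
          then have "d u = (poly (branch_poly Q (Suc (Suc h))) x - poly (branch_poly Q h) x) /
              poly (branch_poly Q (Suc h)) x"
            using h by (simp add: d_def pivot_num_def root_poly_def Q_def del: branch_poly.simps)
          \<comment> \<open>The \<open>k\<close> children cancel both the \<open>Q P_h\<close> of
            the recursion and the extra \<open>P_h\<close> of \<open>root_poly\<close>.\<close>
          moreover have "of_nat k = Q + 1" using k by (simp add: Q_def of_nat_diff)
          ultimately show ?thesis using nzh True unfolding sum by (simp add: field_simps)
        next
          case False
          moreover from this h have "l + 1 - length u = Suc (Suc h)" by simp
          ultimately have "d u = poly (branch_poly Q (Suc (Suc h))) x / poly (branch_poly Q (Suc h)) x"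
            using h by (simp add: d_def pivot_num_def Q_def del: branch_poly.simps)
          then show ?thesis using nzh False unfolding sum by (simp add: field_simps Q_def)
        qed
        then show ?thesis by (simp add: C_def)
      qed
    qed
    then show ?thesis using nz
      by (simp add: d_def flip: prod.distrib)
  qed
  \<comment> \<open>The factor \<open>B\<close> makes both sides vanish at the excluded points; it
    is cancelled at the end.\<close>
  then have "poly (B * (p * (\<Prod>v\<in>V. branch_poly Q (l - length v)))) x =
      poly (B * (\<Prod>v\<in>V. pivot_num l k (length v))) x" for x
    by (cases "poly B x = 0") (simp_all add: poly_prod)
  then have "B * (p * (\<Prod>v\<in>V. branch_poly Q (l - length v))) = B * (\<Prod>v\<in>V. pivot_num l k (length v))"
    by (simp add: poly_eq_poly_eq_iff[symmetric] fun_eq_iff del: poly_mult)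
  then show ?thesis using Bnz by (simp add: p_def V_def Q_def)
qed

text \<open>\<open>root_energy\<close> turns the product over the vertices into a sum, in which each
  level is weighted by its size and the root stands apart.\<close>

lemma energy_dendrimer_eq_root_energies:
  assumes l: "l \<ge> 1" and k: "k \<ge> 1"
  shows "energy (dendrimer l k) =
    root_energy (root_poly (of_nat (k - 1)) l) - root_energy (branch_poly (of_nat (k - 1)) l) +
    (\<Sum>m = 1..l. real (k * (k - 1) ^ (m - 1)) *
      (root_energy (branch_poly (of_nat (k - 1)) (l + 1 - m)) - root_energy (branch_poly (of_nat (k - 1)) (l - m))))"
proof -
  define V where "V = dendrimer_verts l k"
  obtain vs where vs: "distinct vs" "set vs = V"
    "\<And>i j. i < j \<Longrightarrow> j < length vs \<Longrightarrow> length (vs ! i) \<le> length (vs ! j)"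
    using sorted_by_length_enumeration[OF finite_dendrimer_verts[of l k]] unfolding V_def by blast
  define p where "p = char_poly (adj_matrix (dendrimer l k) vs)"
  have pivot_nz: "pivot_num l k m \<noteq> 0" for m by (simp add: pivot_num_def)
  have eq: "p * (\<Prod>v\<in>V. branch_poly (of_nat (k - 1)) (l - length v)) = (\<Prod>v\<in>V. pivot_num l k (length v))"
    using char_poly_dendrimer[OF l k vs(1) _ vs(3)] vs(2) by (simp add: p_def V_def)
  have finV: "finite V" by (simp add: V_def finite_dendrimer_verts)
  have prod_nz: "(\<Prod>v\<in>V. branch_poly (of_nat (k - 1)) (l - length v)) \<noteq> (0 :: complex poly)"
    using finV by simp
  have "p \<noteq> 0" using eq pivot_nz finV by (metis mult_zero_left prod_zero_iff)
  then have "root_energy p + (\<Sum>v\<in>V. root_energy (branch_poly (of_nat (k - 1)) (l - length v))) =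
      (\<Sum>v\<in>V. root_energy (pivot_num l k (length v)))"
    using arg_cong[OF eq, of root_energy] prod_nz pivot_nz by (simp add: root_energy_mult root_energy_prod)
  then have "root_energy p = (\<Sum>v\<in>V. root_energy (pivot_num l k (length v)) -
      root_energy (branch_poly (of_nat (k - 1)) (l - length v)))"
    by (simp add: sum_subtractf)
  also have "\<dots> = root_energy (root_poly (of_nat (k - 1)) l) - root_energy (branch_poly (of_nat (k - 1)) l) +
    (\<Sum>m = 1..l. real (k * (k - 1) ^ (m - 1)) *
      (root_energy (pivot_num l k m) - root_energy (branch_poly (of_nat (k - 1)) (l - m))))"
    unfolding V_def by (subst sum_dendrimer_levels) (simp add: pivot_num_def)
  finally show ?thesis
    using energy_eq[of vs "dendrimer l k"] vs
    by (simp add: p_def root_energy_def V_def dendrimer_def pivot_num_def)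
qed

section \<open>Location of the zeros\<close>

text \<open>The positive zeros come from the angles in \<open>(0, pi / 2)\<close> at which
  \<open>sin ((j + 1) t)\<close> vanishes.\<close>

lemma root_energy_branch_poly:
  fixes q :: real
  assumes "q > 0"
  shows "root_energy (branch_poly (of_real q) j) = sqrt q * path_energy j"
proof -
  define t where "t i = real i * (pi / real (j + 1))" for i
  have t: "0 < t i \<and> t i < pi / 2" if "i \<in> {1..j div 2}" for i
  proof -
    have "2 * i < j + 1" "0 < i" using that by auto
    then have "2 * real i < real (j + 1)" by linarith
    then have "2 * (real i / real (j + 1)) < 1" by (simp add: field_simps)
    then have "pi * (2 * (real i / real (j + 1))) < pi * 1" by (intro mult_strict_left_mono) auto
    then show ?thesis using \<open>0 < i\<close> by (simp add: t_def mult_ac)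
  qed
  have "root_energy (branch_poly (of_real q) j) = 2 * (\<Sum>i = 1..j div 2. 2 * sqrt q * cos (t i))"
  proof (rule root_energy_symmetric)
    show "degree (branch_poly (complex_of_real q) j) = j" using degree_branch_poly by blast
    fix i assume i: "i \<in> {1..j div 2}"
    show "2 * sqrt q * cos (t i) > 0" using t[OF i] assms by (intro mult_pos_pos cos_gt_zero) auto
    have "real (j + 1) * t i = real i * pi" by (simp add: t_def)
    then have "sin (real (j + 1) * t i) = 0" by (simp only: sin_npi)
    then have "poly (branch_poly q j) (2 * sqrt q * cos (t i)) * sin (t i) = 0"
      using branch_poly_cos[OF assms, of j "t i"] by simp
    moreover have "sin (t i) > 0" using t[OF i] by (intro sin_gt_zero) auto
    ultimately show "poly (branch_poly (of_real q) j) (complex_of_real (2 * sqrt q * cos (t i))) = 0"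
      by (subst poly_branch_poly_of_real) simp
  next
    show "inj_on (\<lambda>i. 2 * sqrt q * cos (t i)) {1..j div 2}"
    proof (rule inj_onI)
      fix i i' assume i: "i \<in> {1..j div 2}" "i' \<in> {1..j div 2}"
        and "2 * sqrt q * cos (t i) = 2 * sqrt q * cos (t i')"
      then have "cos (t i) = cos (t i')" using assms by simp
      then have "t i = t i'"
        using cos_inj_pi[of "t i" "t i'"] t[OF i(1)] t[OF i(2)] pi_gt_zero by linarith
      then show "i = i'" by (simp add: t_def)
    qed
  qed (use poly_branch_poly_minus in auto)
  then show ?thesis by (simp add: path_energy_def t_def sum_distrib_left mult_ac)
qed

text \<open>
  Divided by \<open>2 \<surd>q\<close>, the \<open>i\<close>-th largest zero of \<open>root_poly q l\<close> lies between those of the Chebyshev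
  polynomials \<open>T\<^bsub>l+1\<^esub>\<close> (equality for \<open>q = 1\<close>) and \<open>U\<^bsub>l+1\<^esub>\<close> (the limit for \<open>q\<close> to infinity).
\<close>

lemma root_poly_zero:
  fixes q :: real
  assumes q: "q \<ge> 1" and l: "l \<ge> 1" and i: "1 \<le> i" "2 * i \<le> l + 1"
  obtains \<phi> where
    "(2 * real i - 1) * (pi / (2 * real (l + 1))) \<le> \<phi>" "\<phi> < real i * (pi / real (l + 2))"
    "q = 1 \<Longrightarrow> \<phi> = (2 * real i - 1) * (pi / (2 * real (l + 1)))"
    "poly (root_poly q l) (2 * sqrt q * cos \<phi>) = 0"
proof -
  define a where "a = (2 * real i - 1) * (pi / (2 * real (l + 1)))"
  define b where "b = real i * (pi / real (l + 2))"
  \<comment> \<open>The sign \<open>(- 1) ^ i\<close> makes \<open>h\<close> nonpositive at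
    \<open>a\<close> and positive at \<open>b\<close> for every \<open>i\<close>.\<close>
  define h where "h t = (- 1) ^ i * (sin (real (l + 2) * t) - sin (real l * t) / q)" for t
  have ri: "real i \<ge> 1" "2 * real i \<le> real l + 1" using i by linarith+
  have a_pos: "0 < a" using ri by (simp add: a_def)
  have ab: "a < b"
  proof -
    have "(2 * real i - 1) / (2 * real (l + 1)) < real i / real (l + 2)"
      using ri by (simp add: field_simps)
    then have "pi * ((2 * real i - 1) / (2 * real (l + 1))) < pi * (real i / real (l + 2))"
      by (intro mult_strict_left_mono) auto
    then show ?thesis by (simp add: a_def b_def mult_ac)
  qed
  have b_less: "b < pi / 2"
  proof -
    have "real i / real (l + 2) < 1 / 2" using ri by (simp add: field_simps)
    then have "pi * (real i / real (l + 2)) < pi * (1 / 2)" by (intro mult_strict_left_mono) auto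
    then show ?thesis by (simp add: b_def mult_ac)
  qed
  have root: "poly (root_poly q l) (2 * sqrt q * cos t) = 0" if "h t = 0" "a \<le> t" "t \<le> b" for t
  proof -
    have "sin t > 0" using that a_pos b_less by (intro sin_gt_zero) auto
    moreover have "sin (real (l + 2) * t) - sin (real l * t) / q = 0"
      using that(1) by (simp add: h_def)
    ultimately show ?thesis using root_poly_cos[of q l t] q l by simp
  qed
  have h_a: "h a = - (cos a * (1 - 1 / q))"
  proof -
    have half: "real (l + 1) * a = real i * pi - pi / 2"
      by (simp add: a_def field_simps)
    have "cos (real (l + 1) * a) = 0" "sin (real (l + 1) * a) = - ((- 1) ^ i)"
      unfolding half by (simp_all add: cos_diff sin_diff cos_npi)
    moreover have "real (l + 2) * a = real (l + 1) * a + a" "real l * a = real (l + 1) * a - a"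
      by (auto simp: algebra_simps)
    ultimately have "sin (real (l + 2) * a) = - ((- 1) ^ i) * cos a" "sin (real l * a) = - ((- 1) ^ i) * cos a"
      by (simp_all only: sin_add sin_diff)
    then have "h a = (- 1) ^ i * (- ((- 1) ^ i)) * (cos a * (1 - 1 / q))"
      by (simp add: h_def algebra_simps)
    then show ?thesis by (simp flip: power_mult_distrib)
  qed
  have h_b: "h b = sin (2 * b) / q"
  proof -
    have full: "real (l + 2) * b = real i * pi" by (simp add: b_def)
    moreover have "real l * b = real i * pi - 2 * b" using full by (simp add: algebra_simps)
    ultimately have "sin (real (l + 2) * b) = 0" "sin (real l * b) = - ((- 1) ^ i * sin (2 * b))"
      by (simp_all only: sin_diff sin_npi cos_npi)
    then have "h b = (- 1) ^ i * (- 1) ^ i * (sin (2 * b) / q)" by (simp add: h_def)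
    then show ?thesis by (simp flip: power_mult_distrib)
  qed
  have sin_pos: "sin (2 * b) > 0" using a_pos ab b_less by (intro sin_gt_zero) auto
  show thesis
  proof (cases "q = 1")
    \<comment> \<open>The intermediate value theorem does not tell which zero it yields, so for
      \<open>q = 1\<close> the left end is taken explicitly.\<close>
    case True
    then have "h a = 0" by (simp add: h_a)
    then show ?thesis using that[of a] ab root[of a] by (auto simp: a_def b_def)
  next
    case False
    have "h a \<le> 0" using h_a q cos_gt_zero[of a] a_pos ab b_less by (simp add: mult_nonneg_nonneg)
    moreover have "h b > 0" using h_b q sin_pos by simp
    moreover have "continuous_on {a..b} h" unfolding h_def by (intro continuous_intros) (use q in auto)
    ultimately obtain \<phi> where \<phi>: "a \<le> \<phi>" "\<phi> \<le> b" "h \<phi> = 0"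
      using IVT'[of h a 0 b] ab by fastforce
    \<comment> \<open>Strictness here later separates the zeros for different
      \<open>i\<close>.\<close>
    moreover have "\<phi> \<noteq> b" using \<phi> \<open>h b > 0\<close> by auto
    ultimately show ?thesis using that[of \<phi>] root[of \<phi>] False by (auto simp: a_def b_def)
  qed
qed

text \<open>Cosine decreases on \<open>[0, pi]\<close>, so the bounds on the angles turn into
  reversed bounds on the zeros, which are summed.\<close>

lemma root_energy_root_poly:
  fixes q :: real
  assumes q: "q \<ge> 1" and l: "l \<ge> 1"
  shows "root_energy (root_poly (of_real q) l) \<ge> sqrt q * path_energy (l + 1)"
    and "root_energy (root_poly (of_real q) l) \<le> sqrt q * chebyshev_T_energy (l + 1)"
    and "q = 1 \<Longrightarrow> root_energy (root_poly (of_real q) l) = chebyshev_T_energy (l + 1)"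
proof -
  define I where "I = {1..(l + 1) div 2}"
  define a where "a i = (2 * real i - 1) * (pi / (2 * real (l + 1)))" for i
  define b where "b i = real i * (pi / real (l + 2))" for i
  have "\<exists>\<phi>. a i \<le> \<phi> \<and> \<phi> < b i \<and> (q = 1 \<longrightarrow> \<phi> = a i) \<and> poly (root_poly q l) (2 * sqrt q * cos \<phi>) = 0"
    if "i \<in> I" for i
  proof -
    have "1 \<le> i" "2 * i \<le> l + 1" using that by (auto simp: I_def)
    from root_poly_zero[OF q l this] show ?thesis unfolding a_def b_def by metis
  qed
  then obtain \<phi> where \<phi>: "\<And>i. i \<in> I \<Longrightarrow> a i \<le> \<phi> i \<and> \<phi> i < b i"
      "\<And>i. i \<in> I \<Longrightarrow> q = 1 \<Longrightarrow> \<phi> i = a i"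
      "\<And>i. i \<in> I \<Longrightarrow> poly (root_poly q l) (2 * sqrt q * cos (\<phi> i)) = 0"
    by metis
  have ri: "real i \<ge> 1 \<and> 2 * real i \<le> real l + 1" if "i \<in> I" for i
  proof -
    have "1 \<le> i" "2 * i \<le> l + 1" using that by (auto simp: I_def)
    then show ?thesis by linarith
  qed
  have a_pos: "0 < a i" if "i \<in> I" for i using ri[OF that] by (simp add: a_def)
  have b_less: "b i < pi / 2" if "i \<in> I" for i
  proof -
    have "real i / real (l + 2) < 1 / 2" using ri[OF that] by (simp add: field_simps)
    then have "pi * (real i / real (l + 2)) < pi * (1 / 2)" by (intro mult_strict_left_mono) auto
    then show ?thesis by (simp add: b_def mult_ac)
  qed
  \<comment> \<open>The intervals \<open>[a i, b i)\<close> are disjoint and in order, so the chosen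
    angles are distinct.\<close>
  have b_a: "b i \<le> a j" if "i \<in> I" "j \<in> I" "i < j" for i j
  proof -
    have "real i + 1 \<le> real j" using that(3) by linarith
    then have "real i / real (l + 2) \<le> (2 * real j - 1) / (2 * real (l + 1))"
      using ri[OF that(1)] mult_mono[of "real i + 1" "real j" "real l + 2" "real l + 2"]
      by (simp add: field_simps)
    then have "pi * (real i / real (l + 2)) \<le> pi * ((2 * real j - 1) / (2 * real (l + 1)))"
      by (intro mult_left_mono) auto
    then show ?thesis by (simp add: a_def b_def mult_ac)
  qed
  have \<phi>_bounds: "0 < \<phi> i" "\<phi> i < pi / 2" if "i \<in> I" for i
    using \<phi>(1)[OF that] a_pos[OF that] b_less[OF that] by linarith+
  have \<phi>_mono: "\<phi> i < \<phi> j" if "i \<in> I" "j \<in> I" "i < j" for i j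
    using \<phi>(1)[OF that(1)] \<phi>(1)[OF that(2)] b_a[OF that] by linarith
  have "root_energy (root_poly (of_real q) l) = 2 * (\<Sum>i = 1..(l + 1) div 2. 2 * sqrt q * cos (\<phi> i))"
  proof (rule root_energy_symmetric)
    show "degree (root_poly (complex_of_real q) l) = l + 1" by (rule degree_root_poly)
    show "inj_on (\<lambda>i. 2 * sqrt q * cos (\<phi> i)) {1..(l + 1) div 2}"
    proof (rule inj_onI, fold I_def)
      fix i j assume i: "i \<in> I" "j \<in> I"
        and "2 * sqrt q * cos (\<phi> i) = 2 * sqrt q * cos (\<phi> j)"
      then have "cos (\<phi> i) = cos (\<phi> j)" using q by simp
      then have "\<phi> i = \<phi> j"
        using cos_inj_pi[of "\<phi> i" "\<phi> j"] \<phi>_bounds[OF i(1)] \<phi>_bounds[OF i(2)] pi_gt_zero by linarith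
      then show "i = j" using \<phi>_mono[OF i] \<phi>_mono[OF i(2,1)] by (metis less_irrefl nat_neq_iff)
    qed
    fix i assume "i \<in> {1..(l + 1) div 2}"
    then have i: "i \<in> I" by (simp add: I_def)
    show "2 * sqrt q * cos (\<phi> i) > 0"
      using \<phi>_bounds[OF i] q by (intro mult_pos_pos cos_gt_zero) auto
    have "poly (root_poly (complex_of_real q) l) (complex_of_real x) = of_real (poly (root_poly q l) x)" for x
      by (simp add: root_poly_def poly_branch_poly_of_real del: branch_poly.simps)
    then show "poly (root_poly (complex_of_real q) l) (complex_of_real (2 * sqrt q * cos (\<phi> i))) = 0"
      using \<phi>(3)[OF i] by (simp only: of_real_0)
  qed (use l poly_root_poly_minus in auto)
  then have energy: "root_energy (root_poly (of_real q) l) = sqrt q * (4 * (\<Sum>i\<in>I. cos (\<phi> i)))"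
    by (simp add: I_def sum_distrib_left mult_ac)
  have path: "path_energy (l + 1) = 4 * (\<Sum>i\<in>I. cos (b i))"
    by (simp add: path_energy_def I_def b_def)
  have cyc: "chebyshev_T_energy (l + 1) = 4 * (\<Sum>i\<in>I. cos (a i))"
    by (simp add: chebyshev_T_energy_def I_def a_def)
  have "cos (b i) \<le> cos (\<phi> i)" "cos (\<phi> i) \<le> cos (a i)" if "i \<in> I" for i
    using \<phi>(1)[OF that] \<phi>_bounds[OF that] a_pos[OF that] b_less[OF that]
    by (intro cos_monotone_0_pi_le; linarith)+
  then have "(\<Sum>i\<in>I. cos (b i)) \<le> (\<Sum>i\<in>I. cos (\<phi> i))" "(\<Sum>i\<in>I. cos (\<phi> i)) \<le> (\<Sum>i\<in>I. cos (a i))"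
    by (auto intro: sum_mono)
  then show "root_energy (root_poly (of_real q) l) \<ge> sqrt q * path_energy (l + 1)"
    and "root_energy (root_poly (of_real q) l) \<le> sqrt q * chebyshev_T_energy (l + 1)"
    using q unfolding energy path cyc by (auto intro!: mult_left_mono)
  show "root_energy (root_poly (of_real q) l) = chebyshev_T_energy (l + 1)" if "q = 1"
    unfolding energy cyc using that \<phi>(2) by simp
qed

section \<open>Comparison of the closed forms\<close>

text \<open>Apart from the constant \<open>- 2\<close> in \<open>path_energy\<close>, the closed
  forms differ only in the angle, and \<open>csc\<close> and \<open>cot\<close> are larger at the
  smaller angle. This is the source of the constant in the upper bound.\<close>

lemma chebyshev_T_energy_less_path_energy:
  assumes "n \<ge> 2"
  shows "chebyshev_T_energy n < path_energy n + 2"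
proof -
  define a where "a = pi / (2 * real n)"
  define b where "b = pi / (2 * real n + 2)"
  have ab: "0 < b" "b < a" using assms by (auto simp: a_def b_def field_simps intro!: add_pos_nonneg)
  have "pi * 2 \<le> pi * (2 * real n)" using assms by (intro mult_left_mono) auto
  then have a: "a \<le> pi / 2" using assms by (simp add: a_def field_simps)
  have s: "0 < sin b" "sin b < sin a"
    using ab a by (auto intro!: sin_gt_zero sin_monotone_2pi)
  have c: "cos a < cos b" "0 \<le> cos a" using ab a by (auto intro!: cos_monotone_0_pi cos_ge_zero)
  have "csc a < csc b" using s by (simp add: csc_def field_simps)
  moreover have "cot a < cot b" using s c unfolding cot_def by (intro frac_less) auto
  ultimately show ?thesis
    using chebyshev_T_energy_closed[OF assms] path_energy_closed[of n] unfolding a_def b_def by simp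
qed

text \<open>The indices \<open>l + 1\<close> and \<open>l\<close> have opposite parity, so one
  \<open>csc\<close> and one \<open>cot\<close> of the same angle \<open>2 * x\<close> meet, and
  \<open>csc (2 * x) + cot (2 * x) = cot x\<close>.\<close>

lemma chebyshev_T_energy_add_path_energy:
  assumes "l \<ge> 1"
  shows "chebyshev_T_energy (l + 1) + path_energy l = 2 * (cot (pi / (4 * real l + 4)) - 1)"
proof -
  define x where "x = pi / (4 * real l + 4)"
  have x2: "pi / (2 * real (l + 1)) = 2 * x" "pi / (2 * real l + 2) = 2 * x"
    by (auto simp: x_def field_simps)
  have "pi * 2 < pi * (4 * real l + 4)" using assms by (intro mult_strict_left_mono) auto
  then have "0 < x" "x < pi / 2" by (auto simp: x_def field_simps intro!: add_pos_nonneg)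
  then have pos: "sin x > 0" "cos x > 0" by (auto intro!: sin_gt_zero cos_gt_zero)
  have "csc (2 * x) + cot (2 * x) = (1 + cos (2 * x)) / sin (2 * x)"
    by (simp add: csc_def cot_def add_divide_distrib)
  also have "\<dots> = cot x"
    using pos by (simp add: cos_double_cos sin_double cot_def power2_eq_square)
  finally have "csc (2 * x) + cot (2 * x) = cot x" .
  then show ?thesis
    using assms chebyshev_T_energy_closed[of "l + 1", unfolded x2] path_energy_closed[of l, unfolded x2]
    by (simp add: x_def[symmetric])
qed

section \<open>Summation over the levels\<close>

lemma sum_power_Suc:
  fixes a :: "nat \<Rightarrow> real"
  shows "(\<Sum>j<Suc l. a j * q ^ (l - j)) = q * (\<Sum>j<l. a j * q ^ (l - 1 - j)) + a l"
proof -
  have "(\<Sum>j<l. a j * q ^ (l - j)) = (\<Sum>j<l. q * (a j * q ^ (l - 1 - j)))"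
  proof (rule sum.cong[OF refl])
    fix j assume "j \<in> {..<l}"
    then have "l - j = Suc (l - 1 - j)" by auto
    then show "a j * q ^ (l - j) = q * (a j * q ^ (l - 1 - j))" by simp
  qed
  then show ?thesis by (simp add: sum_distrib_left)
qed

text \<open>Shifting the \<open>q\<close> part of the factor \<open>q + 1\<close> by one level pairs
  consecutive differences of \<open>e\<close> into differences over two steps, which for
  \<open>path_energy\<close> are the \<open>dendrimer_coeff\<close>. The assumptions kill the lower
  boundary terms.\<close>

lemma level_sum_rearrange:
  fixes e :: "nat \<Rightarrow> real"
  assumes "e 0 = 0" "e 1 = 0"
  shows "(q + 1) * (\<Sum>j<l. (e (j + 1) - e j) * q ^ (l - 1 - j)) - e l =
    (\<Sum>j<l. (e (j + 2) - e j) * q ^ (l - 1 - j)) - e (l + 1)"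
proof (induction l)
  case (Suc l)
  have "(q + 1) * (\<Sum>j<Suc l. (e (j + 1) - e j) * q ^ (l - j)) =
      q * ((q + 1) * (\<Sum>j<l. (e (j + 1) - e j) * q ^ (l - 1 - j))) + (q + 1) * (e (l + 1) - e l)"
    unfolding sum_power_Suc[of "\<lambda>j. e (j + 1) - e j"] by (simp add: algebra_simps)
  also have "(q + 1) * (\<Sum>j<l. (e (j + 1) - e j) * q ^ (l - 1 - j)) =
      (\<Sum>j<l. (e (j + 2) - e j) * q ^ (l - 1 - j)) - e (l + 1) + e l"
    using Suc by simp
  finally show ?case
    using sum_power_Suc[of "\<lambda>j. e (j + 2) - e j" q l] by (simp add: algebra_simps del: sum.lessThan_Suc)
qed (use assms in auto)

lemma path_energy_0_1: "path_energy 0 = 0" "path_energy 1 = 0"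
  by (auto simp: path_energy_def)

text \<open>An exact formula in which only the energy of \<open>root_poly\<close> is not yet
  explicit; both parts of the theorem start from it.\<close>

lemma energy_dendrimer:
  fixes k l :: nat
  assumes l: "l \<ge> 1" and k: "k \<ge> 2"
  defines "q \<equiv> real k - 1"
  shows "energy (dendrimer l k) = root_energy (root_poly (of_real q) l) +
    sqrt q * ((\<Sum>j<l. dendrimer_coeff j * q ^ (l - 1 - j)) - path_energy (l + 1))"
proof -
  have q: "q > 0" using k by (simp add: q_def)
  have Q: "complex_of_nat (k - 1) = of_real q" "real (k - 1) = q" "real k = q + 1"
    using k by (auto simp: q_def of_nat_diff)
  have "energy (dendrimer l k) = root_energy (root_poly (of_real q) l) - sqrt q * path_energy l +
      (\<Sum>m = 1..l. (q + 1) * q ^ (m - 1) * (sqrt q * (path_energy (l + 1 - m) - path_energy (l - m))))"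
    using energy_dendrimer_eq_root_energies[OF l, of k] k
    unfolding Q of_nat_mult of_nat_power root_energy_branch_poly[OF q]
    by (simp add: right_diff_distrib)
  also have "(\<Sum>m = 1..l. (q + 1) * q ^ (m - 1) * (sqrt q * (path_energy (l + 1 - m) - path_energy (l - m)))) =
      (\<Sum>j<l. (q + 1) * q ^ (l - 1 - j) * (sqrt q * (path_energy (j + 1) - path_energy j)))"
    \<comment> \<open>The index \<open>j = l - m\<close> is the height above the leaves.\<close>
    by (rule sum.reindex_bij_witness[of _ "\<lambda>j. l - j" "\<lambda>m. l - m"]) (auto simp: Suc_diff_le)
  also have "\<dots> = sqrt q * ((q + 1) * (\<Sum>j<l. (path_energy (j + 1) - path_energy j) * q ^ (l - 1 - j)))"
    by (simp add: sum_distrib_left mult_ac)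
  finally have "energy (dendrimer l k) = root_energy (root_poly (of_real q) l) + sqrt q *
      ((q + 1) * (\<Sum>j<l. (path_energy (j + 1) - path_energy j) * q ^ (l - 1 - j)) - path_energy l)"
    by (simp add: right_diff_distrib)
  then show ?thesis
    unfolding level_sum_rearrange[where e = path_energy, OF path_energy_0_1] dendrimer_coeff_eq .
qed

text \<open>The half-integer exponent splits as \<open>1 / 2 + (l - 1 - j)\<close>, which extracts
  \<open>sqrt q\<close> and leaves natural powers.\<close>

lemma sum_powr_eq:
  fixes q :: real
  assumes "q > 0" "l \<ge> 1"
  shows "(\<Sum>j = 0..l - 1. c j * q powr ((real l - 1 / 2) - real j)) =
    sqrt q * (\<Sum>j<l. c j * q ^ (l - 1 - j))"
proof -
  have "c j * q powr ((real l - 1 / 2) - real j) = sqrt q * (c j * q ^ (l - 1 - j))" if "j < l" for j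
  proof -
    have "(real l - 1 / 2) - real j = 1 / 2 + real (l - 1 - j)" using that by (simp add: of_nat_diff)
    then have "q powr ((real l - 1 / 2) - real j) = sqrt q * q ^ (l - 1 - j)"
      using powr_realpow[OF assms(1), of "l - 1 - j"] powr_half_sqrt[of q] assms(1)
      by (simp only: powr_add less_imp_le)
    then show ?thesis by simp
  qed
  then have "(\<Sum>j<l. c j * q powr ((real l - 1 / 2) - real j)) = (\<Sum>j<l. sqrt q * (c j * q ^ (l - 1 - j)))"
    by (intro sum.cong refl) (simp only: lessThan_iff)
  moreover have "{0..l - 1} = {..<l}" using assms(2) by auto
  ultimately show ?thesis by (simp only: sum_distrib_left)
qed

theorem theorem11:
  shows "(\<forall>k l :: nat. k \<ge> 3 \<longrightarrow> l \<ge> 1 \<longrightarrow>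
           energy (dendrimer l k)
             < (\<Sum>j = 0..l - 1. dendrimer_coeff j * (real k - 1) powr ((real l - 1 / 2) - real j))
               + 2 * (real k - 1) powr (1 / 2) \<and>
           energy (dendrimer l k)
             > (\<Sum>j = 0..l - 1. dendrimer_coeff j * (real k - 1) powr ((real l - 1 / 2) - real j))
               - 2.4 * (real k - 1) powr (1 / 2)) \<and>
         (\<forall>l :: nat. l \<ge> 1 \<longrightarrow>
           energy (dendrimer l 2) = 2 * (cot (pi / (4 * real l + 4)) - 1))"
proof (intro conjI allI impI)
  fix k l :: nat
  assume k: "k \<ge> 3" and l: "l \<ge> 1"
  define q where "q = real k - 1"
  have q: "q \<ge> 1" using k by (simp add: q_def)
  have half: "q powr (1 / 2) = sqrt q" using q by (simp add: powr_half_sqrt)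
  have sq: "sqrt q > 0" using q by simp
  define S where "S = sqrt q * (\<Sum>j<l. dendrimer_coeff j * q ^ (l - 1 - j))"
  have sum: "(\<Sum>j = 0..l - 1. dendrimer_coeff j * q powr ((real l - 1 / 2) - real j)) = S"
    unfolding S_def using q by (intro sum_powr_eq l) auto
  have energy: "energy (dendrimer l k) =
      S + (root_energy (root_poly (of_real q) l) - sqrt q * path_energy (l + 1))"
    using energy_dendrimer[OF l, of k] k by (simp add: S_def q_def right_diff_distrib)
  have "sqrt q * chebyshev_T_energy (l + 1) < sqrt q * (path_energy (l + 1) + 2)"
    using chebyshev_T_energy_less_path_energy[of "l + 1"] l sq by (intro mult_strict_left_mono) auto
  then have "root_energy (root_poly (of_real q) l) - sqrt q * path_energy (l + 1) < 2 * sqrt q"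
    using root_energy_root_poly(2)[OF q l] by (simp add: distrib_left)
  then show "energy (dendrimer l k)
      < (\<Sum>j = 0..l - 1. dendrimer_coeff j * (real k - 1) powr ((real l - 1 / 2) - real j))
        + 2 * (real k - 1) powr (1 / 2)"
    unfolding q_def[symmetric] sum half energy by simp
  show "energy (dendrimer l k)
      > (\<Sum>j = 0..l - 1. dendrimer_coeff j * (real k - 1) powr ((real l - 1 / 2) - real j))
        - 2.4 * (real k - 1) powr (1 / 2)"
    \<comment> \<open>The energy is in fact at least \<open>S\<close>; subtracting a positive
      multiple of \<open>sqrt q\<close> makes the inequality strict.\<close>
    using root_energy_root_poly(1)[OF q l] sq unfolding q_def[symmetric] sum half energy by linarith
next
  fix l :: nat
  assume l: "l \<ge> 1"
  \<comment> \<open>For \<open>q = 1\<close> the powers disappear and the differences over two steps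
    telescope; \<open>path_energy (l + 1)\<close> then cancels in
    \<open>energy_dendrimer\<close>.\<close>
  have telescope: "(\<Sum>j<l. dendrimer_coeff j) = path_energy (l + 1) + path_energy l"
    by (induction l) (use path_energy_0_1 in \<open>auto simp: dendrimer_coeff_eq\<close>)
  have "energy (dendrimer l 2) = chebyshev_T_energy (l + 1) + path_energy l"
    using energy_dendrimer[OF l, of 2] root_energy_root_poly(3)[OF order.refl l] telescope by simp
  then show "energy (dendrimer l 2) = 2 * (cot (pi / (4 * real l + 4)) - 1)"
    using chebyshev_T_energy_add_path_energy[OF l] by simp
qed

end
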